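(* Let $G=(G,\cdot)$ be a group with identity $e$ and with an exact factorization $G=HS$ (that is, $H,S$ are subgroups of $G$ with $G=HS$ and $H\cap S=\{e\}$). There is a bijection between (1) binary operations $\star$ on $H$ and transitive actions $\odot$ of $(G,\cdot)$ on $H$ such that $(G,\cdot,H,\star,\odot)$ is a left bracoid containing a brace and with $\mathrm{Stab}_G(e)=S$; and (2) binary operations $+$ on $G$ such that $(G,+,\cdot)$ is a left semibrace in which $G+e=H$ and $E=S$, where $E$ denotes the set of idempotents of $(G,+)$.
   Context: Left bracoid (= left skew bracoid): a quintuple $(G,\cdot,N,\star,\odot)$ where $(G,\cdot)$ and $(N,\star)$ are groups and $\odot$ is a transitive left action of $(G,\cdot)$ on the set $N$ with $x\odot(\eta\star\mu)=(x\odot\eta)\star(x\odot e_N)^{-\star}\star(x\odot\mu)$ for all $x\in G$, $\eta,\mu\in N$ (here $^{-\star}$ is inversion in $(N,\star)$). It contains a brace if there is a subgroup $H$ of $(G,\cdot)$ such that the restricted action makes $(H,N)$ a bracoid with $\mathrm{Stab}_H(e_N)$ trivial (equivalently, $H$ acts regularly on $N$). Convention: when a bracoid containing a brace is written $(G,\cdot,H,\star,\odot)$ with $H$ a subgroup of $(G,\cdot)$, it is understood that $H$ is the subgroup in the definition of containing a brace and that the additive group has been identified with $H$ through $h\mapsto h\odot e_N$. Thus the identity $e$ of $G$ is also the identity of $(H,\star)$, and $h\odot e=h$ for all $h\in H$ (hence $h\odot k=hk$ for $h,k\in H$). Left semibrace: a triple $(G,+,\cdot)$ in which $(G,\cdot)$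 is a group, $(G,+)$ is a left cancellative semigroup ($x+y=x+z$ implies $y=z$), and $x\cdot(y+z)=x\cdot y+x\cdot(x^{-1}+z)$ for all $x,y,z\in G$, where $x^{-1}$ is the inverse in $(G,\cdot)$. The set of idempotents is $E=\{x\in G: x+x=x\}$, and $G+e=\{x+e: x\in G\}$, where $e$ is the identity of $(G,\cdot)$. *)

theory Defs
  imports "HOL-Algebra.Algebra"
begin

text \<open>
  In \<open>group_action\<close> every \<open>act x\<close> belongs to \<open>Bij (carrier N)\<close> and is therefore extensional.
  The two records need not have the same element type.
\<close>

locale left_bracoid = transitive_action G "carrier N" act + N: group N
  for G (structure) and N (structure) and act +
  assumes act_mult:
    "\<lbrakk> x \<in> carrier G; \<eta> \<in> carrier N; \<mu> \<in> carrier N \<rbrakk> \<Longrightarrow>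
      act x (\<eta> \<otimes>\<^bsub>N\<^esub> \<mu>) =
        act x \<eta> \<otimes>\<^bsub>N\<^esub> inv\<^bsub>N\<^esub> (act x \<one>\<^bsub>N\<^esub>) \<otimes>\<^bsub>N\<^esub> act x \<mu>"

text \<open>
  A bracoid \<^emph>\<open>contains a brace\<close> if some \<open>H\<close> as below exists; here \<open>H\<close> is kept as a parameter,
  since the subgroup is part of the data in the notation for such bracoids.
\<close>

locale left_bracoid_containing_brace = left_bracoid G N act
  for G (structure) and N (structure) and act +
  fixes H
  assumes H_subgroup: "subgroup H G"
    and H_bracoid: "left_bracoid (G\<lparr>carrier := H\<rparr>) N act"
    and H_stabilizer: "stabilizer (G\<lparr>carrier := H\<rparr>) act \<one>\<^bsub>N\<^esub> = {\<one>}"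

locale left_semibrace = group G
  for G :: "('a, 'b) monoid_scheme" (structure) and padd :: "'a \<Rightarrow> 'a \<Rightarrow> 'a" (infixl \<open>\<boxplus>\<close> 65) +
  assumes plus_closed: "\<lbrakk> x \<in> carrier G; y \<in> carrier G \<rbrakk> \<Longrightarrow> x \<boxplus> y \<in> carrier G"
    and plus_assoc:
      "\<lbrakk> x \<in> carrier G; y \<in> carrier G; z \<in> carrier G \<rbrakk> \<Longrightarrow> (x \<boxplus> y) \<boxplus> z = x \<boxplus> (y \<boxplus> z)"
    and plus_left_cancel:
      "\<lbrakk> x \<in> carrier G; y \<in> carrier G; z \<in> carrier G; x \<boxplus> y = x \<boxplus> z \<rbrakk> \<Longrightarrow> y = z"
    and mult_plus:
      "\<lbrakk> x \<in> carrier G; y \<in> carrier G; z \<in> carrier G \<rbrakk> \<Longrightarrow>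
        x \<otimes> (y \<boxplus> z) = x \<otimes> y \<boxplus> x \<otimes> (inv x \<boxplus> z)"

definition additive_idempotents :: "('a, 'b) monoid_scheme \<Rightarrow> ('a \<Rightarrow> 'a \<Rightarrow> 'a) \<Rightarrow> 'a set"
  where "additive_idempotents G padd = {x \<in> carrier G. padd x x = x}"

locale exact_factorization = group G for G (structure) and H and S +
  assumes left_subgroup: "subgroup H G"
    and right_subgroup: "subgroup S G"
    and set_mult_eq: "H <#> S = carrier G"
    and Int_eq: "H \<inter> S = {\<one>}"

text \<open>
  Operations and actions in the next two sets are extensional, so that functions
  which agree on the relevant carriers are not counted as different.
  The condition \<open>act h \<one> = h\<close> says that the additive group is identified with \<open>H\<close> through
  the map sending \<open>h\<close> to its action on the additive identity; in particular that identity is \<open>\<one>\<close>.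
\<close>

definition bracoid_structures ::
    "('a, 'b) monoid_scheme \<Rightarrow> 'a set \<Rightarrow> 'a set \<Rightarrow> (('a \<Rightarrow> 'a \<Rightarrow> 'a) \<times> ('a \<Rightarrow> 'a \<Rightarrow> 'a)) set"
  where "bracoid_structures G H S =
    {(star, act).
      star \<in> H \<rightarrow>\<^sub>E H \<rightarrow>\<^sub>E H \<and>
      act \<in> carrier G \<rightarrow>\<^sub>E H \<rightarrow>\<^sub>E H \<and>
      left_bracoid_containing_brace G \<lparr>carrier = H, monoid.mult = star, one = \<one>\<^bsub>G\<^esub>\<rparr> act H \<and>
      (\<forall>h\<in>H. act h \<one>\<^bsub>G\<^esub> = h) \<and>
      stabilizer G act \<one>\<^bsub>G\<^esub> = S}"

definition semibrace_structures ::
    "('a, 'b) monoid_scheme \<Rightarrow> 'a set \<Rightarrow> 'a set \<Rightarrow> ('a \<Rightarrow> 'a \<Rightarrow> 'a) set"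
  where "semibrace_structures G H S =
    {padd.
      padd \<in> carrier G \<rightarrow>\<^sub>E carrier G \<rightarrow>\<^sub>E carrier G \<and>
      left_semibrace G padd \<and>
      (\<lambda>x. padd x \<one>\<^bsub>G\<^esub>) ` carrier G = H \<and>
      additive_idempotents G padd = S}"

end

theory Submission
  imports Defs
begin

text \<open>
  An exact factorization \<open>G = HS\<close> identifies \<open>H\<close> with the coset space \<open>G/S\<close> and \<open>S\<close> with
  \<open>G/H\<close>, and the map \<open>G \<rightarrow> G/S \<times> G/H\<close> is a bijection. Both kinds of structure
  turn out to be nothing more than a suitable group operation \<open>\<star>\<close> on the factor \<open>G/S = H\<close>.

  Write \<open>\<pi> x\<close> for the \<open>H\<close>-part of \<open>x\<close> in \<open>HS\<close>. In a bracoid with \<open>h \<odot> e = h\<close> and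
  \<open>Stab(e) = S\<close> the action is forced to be the coset action \<open>x \<odot> h = \<pi>(xh)\<close>, because
  \<open>x \<odot> h = xh \<odot> e\<close>. Only \<open>\<star>\<close> remains free, subject to the bracoid law
  (\<open>bracoid_structures_iff\<close>).

  From \<open>\<star>\<close> one obtains an addition on \<open>G\<close> by transporting the product of the group \<open>(H,\<star>)\<close> with
  the right zero semigroup on \<open>G/H\<close>: the sum \<open>x + y\<close> is the unique element with
  \<open>\<pi>(x + y) = \<pi> x \<star> \<pi> y\<close> and \<open>(x + y)H = yH\<close>. Left multiplication by \<open>x\<close> acts on each factor
  separately, so the semibrace law can be checked there: on \<open>G/H\<close> it is trivial, and on
  \<open>G/S\<close> it is the bracoid law (\<open>semibrace_of_bracoid\<close>).

  Conversely, in a left semibrace with \<open>G + e = H\<close> and \<open>E = S\<close> the element \<open>x\<^sup>-\<^sup>1(x + e)\<close> is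
  idempotent, so \<open>x + e = \<pi> x\<close>; and every \<open>y\<close> has an idempotent \<open>t\<close> with \<open>y + t = y\<close>,
  from which \<open>(x + y)H = tH = yH\<close> follows. Hence the addition is
  the one constructed from its restriction to \<open>H\<close> (\<open>semibrace_plus_characterization\<close>),
  and that restriction satisfies the bracoid law (\<open>bracoid_of_semibrace\<close>).
\<close>

section \<open>The two coset spaces of an exact factorization\<close>

lemma (in group) inv_mult_cancel_left:
  assumes "a \<in> carrier G" "b \<in> carrier G" "c \<in> carrier G"
  shows "inv (a \<otimes> b) \<otimes> (a \<otimes> c) = inv b \<otimes> c"
  using assms by (metis inv_closed inv_mult_group inv_solve_left m_assoc m_closed)

lemma (in subgroup) quotient_sym:
  assumes "group G" "a \<in> carrier G" "b \<in> carrier G" "inv a \<otimes> b \<in> H"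
  shows "inv b \<otimes> a \<in> H"
proof -
  interpret group G by fact
  show ?thesis using m_inv_closed[OF assms(4)] assms(2,3) by (simp add: inv_mult_group)
qed

lemma (in subgroup) quotient_trans:
  assumes "group G" "a \<in> carrier G" "b \<in> carrier G" "c \<in> carrier G"
    and "inv a \<otimes> b \<in> H" "inv b \<otimes> c \<in> H"
  shows "inv a \<otimes> c \<in> H"
proof -
  interpret group G by fact
  have "inv a \<otimes> c = (inv a \<otimes> b) \<otimes> (inv b \<otimes> c)"
    using assms(2-4) by (simp add: m_assoc) (simp add: m_assoc[symmetric])
  then show ?thesis using assms(5,6) by simp
qed

context exact_factorization
begin

interpretation H: subgroup H G by (rule left_subgroup)
interpretation S: subgroup S G by (rule right_subgroup)

definition proj :: "'a \<Rightarrow> 'a"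
  where "proj x = (THE h. h \<in> H \<and> inv h \<otimes> x \<in> S)"

text \<open>The map \<open>G \<rightarrow> G/S \<times> G/H\<close> is injective.\<close>

lemma eq_if_same_cosets:
  assumes "a \<in> carrier G" "b \<in> carrier G" "inv a \<otimes> b \<in> H" "inv a \<otimes> b \<in> S"
  shows "a = b"
proof -
  have "inv a \<otimes> b = \<one>" using assms(3,4) Int_eq by blast
  then show ?thesis using assms(1,2) by (metis inv_comm inv_equality inv_inv inv_closed)
qed

lemma proj_unique:
  assumes "x \<in> carrier G" "h \<in> H" "inv h \<otimes> x \<in> S"
  shows "proj x = h"
  unfolding proj_def
proof (rule the_equality)
  fix k assume k: "k \<in> H \<and> inv k \<otimes> x \<in> S"
  have "inv k \<otimes> h \<in> S"
    using S.quotient_trans[of k x h] S.quotient_sym[of h x] k assms is_group by auto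
  then show "k = h" using eq_if_same_cosets[of k h] k assms(2) by auto
qed (use assms in auto)

lemma proj_props:
  assumes "x \<in> carrier G"
  shows "proj x \<in> H" "inv (proj x) \<otimes> x \<in> S"
proof -
  obtain h s where hs: "h \<in> H" "s \<in> S" "x = h \<otimes> s"
    using assms set_mult_eq unfolding set_mult_def by blast
  then have "inv h \<otimes> x \<in> S" by (simp add: m_assoc[symmetric])
  then show "proj x \<in> H" "inv (proj x) \<otimes> x \<in> S"
    using proj_unique[OF assms hs(1)] hs(1) by auto
qed

lemma proj_closed [simp]: "x \<in> carrier G \<Longrightarrow> proj x \<in> carrier G"
  using proj_props(1) H.mem_carrier by blast

lemma proj_eq_iff:
  assumes "x \<in> carrier G" "y \<in> carrier G"
  shows "proj x = proj y \<longleftrightarrow> inv x \<otimes> y \<in> S"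
proof
  assume "proj x = proj y"
  then show "inv x \<otimes> y \<in> S"
    using S.quotient_trans[of x "proj x" y] S.quotient_sym[of "proj x" x]
      proj_props(2)[OF assms(1)] proj_props(2)[OF assms(2)] assms is_group
    by simp
next
  assume "inv x \<otimes> y \<in> S"
  then have "inv (proj x) \<otimes> y \<in> S"
    using S.quotient_trans[of "proj x" x y] proj_props assms is_group by auto
  then show "proj x = proj y" using proj_unique proj_props(1) assms by metis
qed

lemma proj_of_H: "h \<in> H \<Longrightarrow> proj h = h"
  by (rule proj_unique) auto

lemma proj_eq_one_iff: "x \<in> carrier G \<Longrightarrow> proj x = \<one> \<longleftrightarrow> x \<in> S"
  using proj_eq_iff[of \<one> x] proj_of_H[of \<one>] by auto

lemma proj_mult_proj:
  assumes "x \<in> carrier G" "y \<in> carrier G"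
  shows "proj (x \<otimes> proj y) = proj (x \<otimes> y)"
  using assms proj_props(2)[of y] by (simp add: proj_eq_iff inv_mult_cancel_left)

text \<open>
  The map \<open>G \<rightarrow> G/S \<times> G/H\<close> is surjective: writing \<open>k\<^sup>-\<^sup>1y = sh\<close>, which is possible because
  \<open>G = SH\<close> as well, the element \<open>ks\<close> lies in \<open>kS \<inter> yH\<close>.
\<close>

lemma ex1_in_both_cosets:
  assumes k: "k \<in> H" and y: "y \<in> carrier G"
  shows "\<exists>!g. g \<in> carrier G \<and> proj g = k \<and> inv y \<otimes> g \<in> H"
proof (rule ex_ex1I)
  define z where "z = inv y \<otimes> k"
  have z: "z \<in> carrier G" using k y by (simp add: z_def)
  define s where "s = inv (inv (proj z) \<otimes> z)"
  have s: "s \<in> S" unfolding s_def using proj_props(2)[OF z] by blast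
  have "inv k \<otimes> (k \<otimes> s) = s" using k s by (simp add: m_assoc[symmetric])
  then have "proj (k \<otimes> s) = k" using k s by (intro proj_unique) auto
  moreover have "inv y \<otimes> (k \<otimes> s) \<in> H"
  proof -
    have "inv y \<otimes> (k \<otimes> s) = z \<otimes> (inv z \<otimes> proj z)"
      using k y z s by (simp add: s_def z_def m_assoc inv_mult_group)
    also have "\<dots> = proj z" using z by (simp add: m_assoc[symmetric])
    finally show ?thesis using proj_props(1)[OF z] by simp
  qed
  moreover have "k \<otimes> s \<in> carrier G" using k s by simp
  ultimately show "\<exists>g. g \<in> carrier G \<and> proj g = k \<and> inv y \<otimes> g \<in> H"
    by (intro exI[of _ "k \<otimes> s"] conjI)
next
  fix g g' assume g: "g \<in> carrier G \<and> proj g = k \<and> inv y \<otimes> g \<in> H"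
    and g': "g' \<in> carrier G \<and> proj g' = k \<and> inv y \<otimes> g' \<in> H"
  have "inv g \<otimes> g' \<in> H"
    using H.quotient_trans[of g y g'] H.quotient_sym[of y g] g g' y is_group by blast
  moreover have "inv g \<otimes> g' \<in> S" using proj_eq_iff[of g g'] g g' by simp
  ultimately show "g = g'" using eq_if_same_cosets g g' by blast
qed

section \<open>Bracoids as operations on one factor\<close>

definition coset_action :: "'a \<Rightarrow> 'a \<Rightarrow> 'a"
  where "coset_action = (\<lambda>x \<in> carrier G. \<lambda>h \<in> H. proj (x \<otimes> h))"

lemma coset_action_eq: "x \<in> carrier G \<Longrightarrow> h \<in> H \<Longrightarrow> coset_action x h = proj (x \<otimes> h)"
  by (simp add: coset_action_def)

lemma coset_action_mult:
  assumes "x \<in> carrier G" "y \<in> carrier G" "h \<in> H"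
  shows "coset_action (x \<otimes> y) h = coset_action x (coset_action y h)"
  using assms by (simp add: coset_action_eq proj_props proj_mult_proj m_assoc)

lemma coset_action_one: "h \<in> H \<Longrightarrow> coset_action \<one> h = h"
  by (simp add: coset_action_eq proj_of_H)

lemma coset_action_Bij:
  assumes x: "x \<in> carrier G"
  shows "coset_action x \<in> Bij H"
proof -
  have "bij_betw (coset_action x) H H"
  proof (rule bij_betw_byWitness[where f' = "coset_action (inv x)"])
    show "\<forall>h\<in>H. coset_action (inv x) (coset_action x h) = h"
      using coset_action_mult[of "inv x" x] x by (simp add: coset_action_one)
    show "\<forall>h\<in>H. coset_action x (coset_action (inv x) h) = h"
      using coset_action_mult[of x "inv x"] x by (simp add: coset_action_one)
  qed (use x in \<open>auto simp: coset_action_eq proj_props\<close>)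
  then show ?thesis using x by (simp add: Bij_def coset_action_def)
qed

lemma coset_action_group_action: "group_action G H coset_action"
proof -
  have "coset_action (x \<otimes> y) = compose H (coset_action x) (coset_action y)"
    if xy: "x \<in> carrier G" "y \<in> carrier G" for x y
  proof
    fix h
    show "coset_action (x \<otimes> y) h = compose H (coset_action x) (coset_action y) h"
      using xy coset_action_mult[OF xy]
      by (cases "h \<in> H") (auto simp: compose_def, simp add: coset_action_def)
  qed
  then show ?thesis
    unfolding group_action_def group_hom_def group_hom_axioms_def hom_def
    using group_BijGroup is_group coset_action_Bij by (auto simp: BijGroup_def)
qed

text \<open>
  A transitive action is determined by a point stabilizer once the point's orbit has been
  labelled; here the labels are the elements of \<open>H\<close>.
\<close>

lemma action_eq_coset_action:
  assumes act: "group_action G H act" and ext: "act \<in> carrier G \<rightarrow>\<^sub>E H \<rightarrow>\<^sub>E H"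
    and base: "\<forall>h\<in>H. act h \<one> = h" and stab: "stabilizer G act \<one> = S"
  shows "act = coset_action"
proof -
  interpret A: group_action G H act by (rule act)
  have act_one: "act g \<one> = proj g" if g: "g \<in> carrier G" for g
  proof -
    have s: "inv (proj g) \<otimes> g \<in> S" using proj_props(2)[OF g] .
    then have fix_one: "act (inv (proj g) \<otimes> g) \<one> = \<one>" using stab unfolding stabilizer_def by blast
    have "g = proj g \<otimes> (inv (proj g) \<otimes> g)" using g by (simp add: m_assoc[symmetric])
    then have "act g \<one> = act (proj g) (act (inv (proj g) \<otimes> g) \<one>)"
      using A.composition_rule[of \<one> "proj g" "inv (proj g) \<otimes> g"] g by simp
    then show ?thesis using fix_one base proj_props(1)[OF g] by simp
  qed
  have "act x h = coset_action x h" if x: "x \<in> carrier G" and h: "h \<in> H" for x h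
  proof -
    have "act x h = act x (act h \<one>)" using base h by simp
    also have "\<dots> = proj (x \<otimes> h)"
      using A.composition_rule[of \<one> x h] act_one[of "x \<otimes> h"] x h by simp
    finally show ?thesis using x h by (simp add: coset_action_eq)
  qed
  moreover have "coset_action \<in> carrier G \<rightarrow>\<^sub>E H \<rightarrow>\<^sub>E H"
    by (auto simp: coset_action_def proj_props)
  ultimately show ?thesis using ext
    by (intro PiE_ext[OF ext]) (auto intro!: PiE_ext[where k = H])
qed

abbreviation additive_monoid :: "('a \<Rightarrow> 'a \<Rightarrow> 'a) \<Rightarrow> 'a monoid"
  where "additive_monoid star \<equiv> \<lparr>carrier = H, monoid.mult = star, one = \<one>\<rparr>"

definition bracoid_law :: "('a \<Rightarrow> 'a \<Rightarrow> 'a) \<Rightarrow> bool"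
  where "bracoid_law star \<longleftrightarrow>
    (\<forall>x\<in>carrier G. \<forall>h\<in>H. \<forall>k\<in>H.
      proj (x \<otimes> star h k) =
        star (star (proj (x \<otimes> h)) (inv\<^bsub>additive_monoid star\<^esub> (proj x))) (proj (x \<otimes> k)))"

lemma bracoid_structures_iff:
  "(star, act) \<in> bracoid_structures G H S \<longleftrightarrow>
    star \<in> H \<rightarrow>\<^sub>E H \<rightarrow>\<^sub>E H \<and> group (additive_monoid star) \<and> bracoid_law star \<and> act = coset_action"
  (is "?L \<longleftrightarrow> ?R")
proof
  let ?N = "additive_monoid star"
  assume L: ?L
  then interpret B: left_bracoid_containing_brace G ?N act H
    by (simp add: bracoid_structures_def)
  have "group_action G H act" using B.group_action_axioms by simp
  then have act: "act = coset_action"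
    using L by (intro action_eq_coset_action) (auto simp: bracoid_structures_def)
  have "bracoid_law star"
    unfolding bracoid_law_def
  proof (intro ballI)
    fix x h k assume xhk: "x \<in> carrier G" "h \<in> H" "k \<in> H"
    have "star h k \<in> H" using B.N.m_closed[of h k] xhk by simp
    then show "proj (x \<otimes> star h k) =
        star (star (proj (x \<otimes> h)) (inv\<^bsub>?N\<^esub> (proj x))) (proj (x \<otimes> k))"
      using B.act_mult[of x h k] xhk by (simp add: act coset_action_eq)
  qed
  then show ?R using L act B.N.is_group by (simp add: bracoid_structures_def)
next
  let ?N = "additive_monoid star"
  assume R: ?R
  then interpret N: group ?N by simp
  interpret A: group_action G H coset_action by (rule coset_action_group_action)
  have star_closed: "star h k \<in> H" if "h \<in> H" "k \<in> H" for h k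
    using N.m_closed[of h k] that by simp
  have law: "coset_action x (star h k) =
      star (star (coset_action x h) (inv\<^bsub>?N\<^esub> (coset_action x \<one>))) (coset_action x k)"
    if "x \<in> carrier G" "h \<in> H" "k \<in> H" for x h k
    using R that star_closed unfolding bracoid_law_def by (simp add: coset_action_eq)
  have base: "coset_action h \<one> = h" if "h \<in> H" for h
    using that by (simp add: coset_action_eq proj_of_H)
  \<comment> \<open>A subgroup containing \<open>H\<close> is transitive: \<open>k h\<^sup>-\<^sup>1\<close> already lies in \<open>H\<close>.\<close>
  have bracoid: "left_bracoid (G\<lparr>carrier := K\<rparr>) ?N coset_action"
    if K: "subgroup K G" and HK: "H \<subseteq> K" for K
  proof -
    have KG: "K \<subseteq> carrier G" using K by (rule subgroup.subset)
    have "group_hom (G\<lparr>carrier := K\<rparr>) (BijGroup H) coset_action"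
      using A.group_hom KG K unfolding group_hom_def group_hom_axioms_def hom_def
      by (auto intro: subgroup.subgroup_is_group)
    then have act: "group_action (G\<lparr>carrier := K\<rparr>) H coset_action"
      by (simp add: group_action_def)
    have trans: "\<exists>g\<in>K. coset_action g h = k" if "h \<in> H" "k \<in> H" for h k
    proof
      show "coset_action (k \<otimes> inv h) h = k"
        using that by (simp add: coset_action_eq m_assoc proj_of_H)
      show "k \<otimes> inv h \<in> K" using that HK by auto
    qed
    show ?thesis
      unfolding left_bracoid_def left_bracoid_axioms_def
        transitive_action_def transitive_action_axioms_def
      using act trans N.is_group law KG by auto
  qed
  have "left_bracoid G ?N coset_action"
    using bracoid[OF subgroup_self H.subset] by simp
  moreover have "left_bracoid (G\<lparr>carrier := H\<rparr>) ?N coset_action"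
    using bracoid[OF left_subgroup] by simp
  moreover have "stabilizer (G\<lparr>carrier := H\<rparr>) coset_action \<one> = {\<one>}"
    using base by (auto simp: stabilizer_def)
  ultimately have "left_bracoid_containing_brace G ?N coset_action H"
    unfolding left_bracoid_containing_brace_def left_bracoid_containing_brace_axioms_def
    using left_subgroup by simp
  moreover have "stabilizer G coset_action \<one> = S"
    by (auto simp: stabilizer_def coset_action_eq proj_eq_one_iff)
  moreover have "coset_action \<in> carrier G \<rightarrow>\<^sub>E H \<rightarrow>\<^sub>E H"
    by (auto simp: coset_action_def proj_props)
  ultimately show ?L using R base by (simp add: bracoid_structures_def)
qed

section \<open>From bracoids to semibraces\<close>

definition coset_sum :: "('a \<Rightarrow> 'a \<Rightarrow> 'a) \<Rightarrow> 'a \<Rightarrow> 'a \<Rightarrow> 'a"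
  where "coset_sum star = (\<lambda>x \<in> carrier G. \<lambda>y \<in> carrier G.
    THE g. g \<in> carrier G \<and> proj g = star (proj x) (proj y) \<and> inv y \<otimes> g \<in> H)"

lemma coset_sum_props:
  assumes "star \<in> H \<rightarrow> H \<rightarrow> H" "x \<in> carrier G" "y \<in> carrier G"
  shows "coset_sum star x y \<in> carrier G"
    and "proj (coset_sum star x y) = star (proj x) (proj y)"
    and "inv y \<otimes> coset_sum star x y \<in> H"
proof -
  have "star (proj x) (proj y) \<in> H" using assms proj_props(1) by (auto simp: Pi_iff)
  from theI'[OF ex1_in_both_cosets[OF this assms(3)]]
  have "coset_sum star x y \<in> carrier G \<and>
      proj (coset_sum star x y) = star (proj x) (proj y) \<and> inv y \<otimes> coset_sum star x y \<in> H"
    by (simp only: coset_sum_def restrict_apply' assms(2,3))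
  then show "coset_sum star x y \<in> carrier G"
    and "proj (coset_sum star x y) = star (proj x) (proj y)"
    and "inv y \<otimes> coset_sum star x y \<in> H"
    by simp_all
qed

lemma coset_sum_unique:
  assumes "star \<in> H \<rightarrow> H \<rightarrow> H" "x \<in> carrier G" "y \<in> carrier G"
    and "g \<in> carrier G" "proj g = star (proj x) (proj y)" "inv y \<otimes> g \<in> H"
  shows "coset_sum star x y = g"
proof -
  have "star (proj x) (proj y) \<in> H" using assms(1-3) proj_props(1) by (auto simp: Pi_iff)
  note ex1 = ex1_in_both_cosets[OF this assms(3)]
  have "coset_sum star x y =
      (THE g. g \<in> carrier G \<and> proj g = star (proj x) (proj y) \<and> inv y \<otimes> g \<in> H)"
    by (simp only: coset_sum_def restrict_apply' assms(2,3))
  also have "\<dots> = g"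
    by (rule the1_equality[OF ex1]) (intro conjI assms(4-6))
  finally show ?thesis .
qed

lemma coset_sum_of_H:
  assumes "star \<in> H \<rightarrow> H \<rightarrow> H" "h \<in> H" "k \<in> H"
  shows "coset_sum star h k = star h k"
proof (rule coset_sum_unique)
  have "star h k \<in> H" using assms by (auto simp: Pi_iff)
  then show "star h k \<in> carrier G" "proj (star h k) = star (proj h) (proj k)"
      "inv k \<otimes> star h k \<in> H"
    using assms(2,3) by (simp_all add: proj_of_H)
qed (use assms in auto)

text \<open>
  Two elements are equal if they agree in \<open>G/S\<close> and in \<open>G/H\<close>, so every law is verified in both
  quotients. In \<open>G/H\<close> a sum is represented by its last summand. In \<open>G/S\<close> the semibrace law for
  \<open>x(y + z)\<close> becomes the bracoid law, since \<open>x \<odot> \<pi>(x\<^sup>-\<^sup>1) = e\<close>.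
\<close>

lemma semibrace_of_bracoid:
  assumes ext: "star \<in> H \<rightarrow>\<^sub>E H \<rightarrow>\<^sub>E H" and grp: "group (additive_monoid star)"
    and law: "bracoid_law star"
  shows "coset_sum star \<in> semibrace_structures G H S"
proof -
  let ?N = "additive_monoid star"
  interpret N: group ?N by (rule grp)
  have funs: "star \<in> H \<rightarrow> H \<rightarrow> H" using ext by (auto simp: PiE_iff Pi_iff)
  note P = coset_sum_props[OF funs]
  have star_closed: "star h k \<in> H" if "h \<in> H" "k \<in> H" for h k
    using N.m_closed[of h k] that by simp
  have star_one: "star \<one> h = h" "star h \<one> = h" if "h \<in> H" for h
    using N.l_one[of h] N.r_one[of h] that by simp_all
  have star_assoc: "star (star h k) l = star h (star k l)" if "h \<in> H" "k \<in> H" "l \<in> H" for h k l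
    using N.m_assoc[of h k l] that by simp
  have star_cancel: "k = l" if "h \<in> H" "k \<in> H" "l \<in> H" "star h k = star h l" for h k l
    using N.l_cancel[of h k l] that by simp
  have Ninv: "inv\<^bsub>?N\<^esub> h \<in> H" if "h \<in> H" for h
    using N.inv_closed[of h] that by simp
  have "left_semibrace G (coset_sum star)"
  proof
    fix x y z assume xyz: "x \<in> carrier G" "y \<in> carrier G" "z \<in> carrier G"
    define v where "v = coset_sum star y z"
    have v: "v \<in> carrier G" "proj v = star (proj y) (proj z)" "inv z \<otimes> v \<in> H"
      unfolding v_def using P[OF xyz(2,3)] by simp_all
    have xv: "coset_sum star x v \<in> carrier G" "proj (coset_sum star x v) = star (proj x) (proj v)"
        "inv v \<otimes> coset_sum star x v \<in> H"
      using P[OF xyz(1) v(1)] by simp_all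
    have "coset_sum star (coset_sum star x y) z = coset_sum star x v"
    proof (rule coset_sum_unique[OF funs P(1)[OF xyz(1,2)] xyz(3) xv(1)])
      show "proj (coset_sum star x v) = star (proj (coset_sum star x y)) (proj z)"
        using xyz by (simp add: xv(2) v(2) P(2) star_assoc proj_props(1))
      show "inv z \<otimes> coset_sum star x v \<in> H"
        by (rule H.quotient_trans[OF is_group xyz(3) v(1) xv(1) v(3) xv(3)])
    qed
    then show "coset_sum star (coset_sum star x y) z = coset_sum star x (coset_sum star y z)"
      by (simp add: v_def)
  next
    fix x y z assume xyz: "x \<in> carrier G" "y \<in> carrier G" "z \<in> carrier G"
      and eq: "coset_sum star x y = coset_sum star x z"
    have "star (proj x) (proj y) = star (proj x) (proj z)" using P(2) xyz eq by metis
    then have "proj y = proj z" using star_cancel[of "proj x"] proj_props(1) xyz by blast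
    then have "inv y \<otimes> z \<in> S" using proj_eq_iff xyz by blast
    moreover have "inv y \<otimes> z \<in> H"
      using H.quotient_trans[of y "coset_sum star x y" z] H.quotient_sym[of z "coset_sum star x y"]
        is_group xyz P eq by metis
    ultimately show "y = z" using eq_if_same_cosets xyz by blast
  next
    fix x y z assume xyz: "x \<in> carrier G" "y \<in> carrier G" "z \<in> carrier G"
    define v where "v = coset_sum star (inv x) z"
    have v: "v \<in> carrier G" "proj v = star (proj (inv x)) (proj z)" "inv z \<otimes> v \<in> H"
      unfolding v_def using P xyz by auto
    define w where "w = coset_sum star y z"
    have w: "w \<in> carrier G" "proj w = star (proj y) (proj z)" "inv z \<otimes> w \<in> H"
      unfolding w_def using P xyz by auto
    note in_H = proj_props(1)
    have xv: "proj (x \<otimes> v) = star (inv\<^bsub>?N\<^esub> (proj x)) (proj (x \<otimes> z))"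
    proof -
      have "proj (x \<otimes> v) = proj (x \<otimes> star (proj (inv x)) (proj z))"
        using proj_mult_proj[of x v] v xyz by simp
      also have "\<dots> = star (star (proj (x \<otimes> inv x)) (inv\<^bsub>?N\<^esub> (proj x))) (proj (x \<otimes> z))"
        using law[unfolded bracoid_law_def, rule_format, of x "proj (inv x)" "proj z"] xyz in_H
        by (simp add: proj_mult_proj)
      finally show ?thesis using xyz in_H Ninv by (simp add: proj_of_H star_one)
    qed
    have "proj (x \<otimes> w) = proj (x \<otimes> star (proj y) (proj z))"
      using proj_mult_proj[of x w] w xyz by simp
    also have "\<dots> = star (star (proj (x \<otimes> y)) (inv\<^bsub>?N\<^esub> (proj x))) (proj (x \<otimes> z))"
      using law[unfolded bracoid_law_def, rule_format, of x "proj y" "proj z"] xyz in_H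
      by (simp add: proj_mult_proj)
    also have "\<dots> = star (proj (x \<otimes> y)) (proj (x \<otimes> v))"
      using xyz in_H Ninv by (simp add: xv star_assoc)
    finally have "proj (x \<otimes> w) = star (proj (x \<otimes> y)) (proj (x \<otimes> v))" .
    moreover have "inv (x \<otimes> v) \<otimes> (x \<otimes> w) \<in> H"
      using H.quotient_trans[of v z w] H.quotient_sym[of z v] v w xyz is_group
      by (simp add: inv_mult_cancel_left)
    ultimately have "coset_sum star (x \<otimes> y) (x \<otimes> v) = x \<otimes> w"
      using xyz v w by (intro coset_sum_unique[OF funs]) auto
    then show "x \<otimes> coset_sum star y z =
        coset_sum star (x \<otimes> y) (x \<otimes> coset_sum star (inv x) z)"
      by (simp add: v_def w_def)
  qed (use P in auto)
  moreover have sum_one: "coset_sum star x \<one> = proj x" if x: "x \<in> carrier G" for x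
    using x proj_props(1)[OF x]
    by (intro coset_sum_unique[OF funs]) (auto simp: proj_of_H star_one)
  then have "(\<lambda>x. coset_sum star x \<one>) ` carrier G = H"
    using proj_props(1) proj_of_H by (auto simp: image_iff) (metis H.mem_carrier)
  moreover have "additive_idempotents G (coset_sum star) = S"
  proof -
    have "coset_sum star x x = x \<longleftrightarrow> x \<in> S" if x: "x \<in> carrier G" for x
    proof
      assume "coset_sum star x x = x"
      then have "star (proj x) (proj x) = star (proj x) \<one>"
        using P(2)[OF x x] star_one proj_props(1)[OF x] by simp
      then have "proj x = \<one>" using star_cancel[of "proj x" "proj x" \<one>] proj_props(1)[OF x] by simp
      then show "x \<in> S" using proj_eq_one_iff[OF x] by simp
    next
      assume "x \<in> S"
      then have "proj x = \<one>" using proj_eq_one_iff[OF x] by simp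
      then show "coset_sum star x x = x"
        using x by (intro coset_sum_unique[OF funs]) (auto simp: star_one)
    qed
    then show ?thesis by (auto simp: additive_idempotents_def)
  qed
  moreover have "coset_sum star \<in> carrier G \<rightarrow>\<^sub>E carrier G \<rightarrow>\<^sub>E carrier G"
  proof (intro PiE_I)
    fix x y assume "x \<in> carrier G" "y \<in> carrier G"
    then show "coset_sum star x y \<in> carrier G" by (rule P(1))
  qed (simp_all add: coset_sum_def)
  ultimately show ?thesis by (simp add: semibrace_structures_def)
qed

end

section \<open>Idempotents of a left semibrace\<close>

context left_semibrace
begin

lemma one_plus:
  assumes "z \<in> carrier G"
  shows "\<one> \<boxplus> z = z"
proof -
  have "\<one> \<boxplus> z = \<one> \<boxplus> (\<one> \<boxplus> z)"
    using mult_plus[of \<one> \<one> z] assms by (simp add: plus_closed)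
  then show ?thesis using plus_left_cancel[of \<one> z "\<one> \<boxplus> z"] assms by (simp add: plus_closed)
qed

lemma mult_eq_plus:
  assumes "x \<in> carrier G" "z \<in> carrier G"
  shows "x \<otimes> z = x \<boxplus> x \<otimes> (inv x \<boxplus> z)"
  using mult_plus[of x \<one> z] assms by (simp add: one_plus)

lemma plus_right_inverse:
  assumes "x \<in> carrier G"
  shows "x \<boxplus> x \<otimes> (inv x \<boxplus> inv x) = \<one>"
  using mult_eq_plus[of x "inv x"] assms by simp

lemma quotient_idempotent:
  assumes "x \<in> carrier G"
  shows "inv x \<otimes> (x \<boxplus> \<one>) \<in> additive_idempotents G padd"
proof -
  have "(x \<boxplus> \<one>) \<boxplus> \<one> = x \<boxplus> \<one>" using assms by (simp add: plus_assoc one_plus)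
  then have "inv x \<otimes> (x \<boxplus> \<one>) = inv x \<otimes> (x \<boxplus> \<one>) \<boxplus> inv x \<otimes> (x \<boxplus> \<one>)"
    using mult_plus[of "inv x" "x \<boxplus> \<one>" \<one>] assms by (simp add: plus_closed)
  then show ?thesis using assms by (simp add: additive_idempotents_def plus_closed)
qed

lemma idempotent_mult_plus:
  assumes "x \<in> carrier G" "s \<in> additive_idempotents G padd"
  shows "inv s \<otimes> (x \<boxplus> s) = inv s \<otimes> x \<boxplus> \<one>"
  using mult_plus[of "inv s" x s] assms by (simp add: additive_idempotents_def)

text \<open>Each \<open>y\<close> absorbs \<open>y' + y\<close> on the right, where \<open>y'\<close> is a right negative of \<open>y\<close>.\<close>

lemma ex_idempotent_right_neutral:
  assumes y: "y \<in> carrier G"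
  shows "\<exists>t \<in> additive_idempotents G padd. y \<boxplus> t = y"
proof
  define y' where "y' = y \<otimes> (inv y \<boxplus> inv y)"
  have y': "y' \<in> carrier G" "y \<boxplus> y' = \<one>"
    using plus_right_inverse[OF y] y by (simp_all add: y'_def plus_closed)
  have absorb: "y \<boxplus> (y' \<boxplus> y) = y"
    using plus_assoc[OF y y'(1) y] y'(2) one_plus[OF y] by simp
  then show "y \<boxplus> (y' \<boxplus> y) = y" .
  show "y' \<boxplus> y \<in> additive_idempotents G padd"
    using absorb y y'(1) by (simp add: additive_idempotents_def plus_closed plus_assoc)
qed

end

section \<open>From semibraces to bracoids\<close>

context exact_factorization
begin

interpretation H: subgroup H G by (rule left_subgroup)
interpretation S: subgroup S G by (rule right_subgroup)

lemma semibrace_plus_one: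
  assumes padd: "padd \<in> semibrace_structures G H S" and x: "x \<in> carrier G"
  shows "padd x \<one> = proj x"
proof -
  interpret left_semibrace G padd using padd by (simp add: semibrace_structures_def)
  have "padd x \<one> \<in> H" using padd x by (auto simp: semibrace_structures_def)
  moreover have "inv x \<otimes> padd x \<one> \<in> S"
    using quotient_idempotent[OF x] padd by (simp add: semibrace_structures_def)
  then have "inv (padd x \<one>) \<otimes> x \<in> S"
    using S.quotient_sym is_group x plus_closed by blast
  ultimately show ?thesis using proj_unique[OF x] by simp
qed

text \<open>
  The restriction of the addition to \<open>H\<close> determines all of it. The second conclusion holds for
  idempotent \<open>y = s\<close> because \<open>s\<^sup>-\<^sup>1(x + s) = s\<^sup>-\<^sup>1x + e\<close> belongs to \<open>G + e\<close>; for general \<open>y\<close>, take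
  an idempotent \<open>t\<close> with \<open>y + t = y\<close> and compare \<open>x + y = (x + y) + t\<close> and \<open>y = y + t\<close>
  with \<open>t\<close>.
\<close>

lemma semibrace_plus_characterization:
  assumes padd: "padd \<in> semibrace_structures G H S" and x: "x \<in> carrier G" and y: "y \<in> carrier G"
  shows "proj (padd x y) = padd (proj x) (proj y)"
    and "inv y \<otimes> padd x y \<in> H"
proof -
  interpret left_semibrace G padd using padd by (simp add: semibrace_structures_def)
  show "proj (padd x y) = padd (proj x) (proj y)"
    using x y plus_closed by (simp add: semibrace_plus_one[OF padd, symmetric] plus_assoc one_plus)
  obtain t where t: "t \<in> additive_idempotents G padd" "padd y t = y"
    using ex_idempotent_right_neutral[OF y] by blast
  have tG: "t \<in> carrier G" using t(1) by (simp add: additive_idempotents_def)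
  have same_coset: "inv t \<otimes> padd g t \<in> H" if "g \<in> carrier G" for g
    using idempotent_mult_plus[OF that t(1)] that tG
      proj_props(1)[of "inv t \<otimes> g"] semibrace_plus_one[OF padd, of "inv t \<otimes> g"] by simp
  have "inv t \<otimes> y \<in> H" using same_coset[OF y] t(2) by simp
  moreover have "inv t \<otimes> padd x y \<in> H"
    using same_coset[of "padd x y"] x y tG t(2) by (simp add: plus_closed plus_assoc)
  ultimately show "inv y \<otimes> padd x y \<in> H"
    using H.quotient_trans[of y t "padd x y"] H.quotient_sym[of t y] is_group x y tG plus_closed
    by blast
qed

definition restricted_sum :: "('a \<Rightarrow> 'a \<Rightarrow> 'a) \<Rightarrow> 'a \<Rightarrow> 'a \<Rightarrow> 'a"
  where "restricted_sum padd = (\<lambda>h \<in> H. \<lambda>k \<in> H. padd h k)"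

lemma restricted_sum_closed:
  assumes padd: "padd \<in> semibrace_structures G H S"
  shows "restricted_sum padd \<in> H \<rightarrow>\<^sub>E H \<rightarrow>\<^sub>E H"
proof -
  interpret left_semibrace G padd using padd by (simp add: semibrace_structures_def)
  have "padd h k \<in> H" if "h \<in> H" "k \<in> H" for h k
    using semibrace_plus_characterization(1)[OF padd, of h k] that proj_props(1)[of "padd h k"]
    by (simp add: plus_closed proj_of_H)
  then show ?thesis by (auto simp: restricted_sum_def)
qed

lemma coset_sum_restricted_sum:
  assumes padd: "padd \<in> semibrace_structures G H S"
  shows "coset_sum (restricted_sum padd) = padd"
proof -
  interpret left_semibrace G padd using padd by (simp add: semibrace_structures_def)
  have funs: "restricted_sum padd \<in> H \<rightarrow> H \<rightarrow> H"
    using restricted_sum_closed[OF padd] by (auto simp: PiE_iff Pi_iff)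
  have eq: "coset_sum (restricted_sum padd) x y = padd x y"
    if "x \<in> carrier G" "y \<in> carrier G" for x y
    using that semibrace_plus_characterization[OF padd that] proj_props(1) plus_closed
    by (intro coset_sum_unique[OF funs]) (auto simp: restricted_sum_def)
  have padd_ext: "padd \<in> carrier G \<rightarrow>\<^sub>E carrier G \<rightarrow>\<^sub>E carrier G"
    using padd by (simp add: semibrace_structures_def)
  show ?thesis
  proof (intro ext)
    fix x y
    show "coset_sum (restricted_sum padd) x y = padd x y"
    proof (cases "x \<in> carrier G \<and> y \<in> carrier G")
      case False
      have "x \<notin> carrier G \<Longrightarrow> padd x = undefined"
        using padd_ext by (rule PiE_arb)
      moreover have "x \<in> carrier G \<Longrightarrow> y \<notin> carrier G \<Longrightarrow> padd x y = undefined"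
        using PiE_mem[OF padd_ext] PiE_arb by metis
      ultimately show ?thesis using False by (auto simp: coset_sum_def)
    qed (use eq in simp)
  qed
qed

text \<open>
  Inverses in \<open>(H,+)\<close> come from right negatives in \<open>G\<close>, made elements of \<open>H\<close> by adding \<open>e\<close>.
  For the bracoid law, put \<open>w = x(x\<^sup>-\<^sup>1 + k)\<close>: the semibrace law reads \<open>x(h + k) = xh + w\<close>,
  and its instance \<open>xk = x + w\<close> shows that \<open>\<pi> w\<close> is the sum of the negative of \<open>\<pi> x\<close> and \<open>\<pi>(xk)\<close>.
\<close>

lemma bracoid_of_semibrace:
  assumes padd: "padd \<in> semibrace_structures G H S"
  shows "group (additive_monoid (restricted_sum padd))" (is "group ?N")
    and "bracoid_law (restricted_sum padd)"
proof -
  interpret left_semibrace G padd using padd by (simp add: semibrace_structures_def)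
  note plus_proj = semibrace_plus_characterization(1)[OF padd]
  have closed: "padd h k \<in> H" if "h \<in> H" "k \<in> H" for h k
    using restricted_sum_closed[OF padd] that by (auto simp: restricted_sum_def PiE_iff)
  have sum_eq: "restricted_sum padd h k = padd h k" if "h \<in> H" "k \<in> H" for h k
    using that by (simp add: restricted_sum_def)
  have plus_one: "padd h \<one> = h" if "h \<in> H" for h
    using semibrace_plus_one[OF padd, of h] that by (simp add: proj_of_H)
  have monoid: "Group.monoid ?N"
    by (rule monoidI) (auto simp: sum_eq closed plus_assoc one_plus plus_one)
  have right_inverse: "\<exists>k \<in> H. padd h k = \<one>" if h: "h \<in> H" for h
  proof
    define y where "y = h \<otimes> padd (inv h) (inv h)"
    have y: "y \<in> carrier G" "padd h y = \<one>"
      using plus_right_inverse[of h] h by (simp_all add: y_def plus_closed)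
    show "proj y \<in> H" using proj_props(1) y by simp
    show "padd h (proj y) = \<one>" using plus_proj[of h y] h y by (simp add: proj_of_H)
  qed
  show grp: "group ?N"
  proof (rule monoid.group_l_invI[OF monoid])
    fix h assume "h \<in> carrier ?N"
    then have h: "h \<in> H" by simp
    obtain k where k: "k \<in> H" "padd h k = \<one>" using right_inverse[OF h] by blast
    obtain l where l: "l \<in> H" "padd k l = \<one>" using right_inverse[OF k(1)] by blast
    have "h = padd h (padd k l)" using l plus_one[OF h] by simp
    also have "\<dots> = padd (padd h k) l" using plus_assoc[of h k l] h k(1) l(1) by simp
    also have "\<dots> = l" using k l by (simp add: one_plus)
    finally have "padd k h = \<one>" using l by simp
    then show "\<exists>k\<in>carrier ?N. k \<otimes>\<^bsub>?N\<^esub> h = \<one>\<^bsub>?N\<^esub>"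
      using k h by (auto simp: sum_eq)
  qed
  interpret N: group ?N by (rule grp)
  show "bracoid_law (restricted_sum padd)"
    unfolding bracoid_law_def
  proof (intro ballI)
    fix x h k assume xhk: "x \<in> carrier G" "h \<in> H" "k \<in> H"
    define w where "w = x \<otimes> padd (inv x) k"
    have w: "w \<in> carrier G" using xhk by (simp add: w_def plus_closed)
    define i where "i = inv\<^bsub>?N\<^esub> (proj x)"
    note in_H = proj_props(1)
    have i: "i \<in> H" using N.inv_closed[of "proj x"] xhk in_H by (simp add: i_def)
    have i_left: "padd i (proj x) = \<one>"
      using N.l_inv[of "proj x"] i in_H xhk by (simp add: i_def[symmetric] sum_eq)
    have "proj (x \<otimes> k) = padd (proj x) (proj w)"
      using plus_proj[of x w] mult_eq_plus[of x k] xhk w by (simp add: w_def)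
    then have "padd i (proj (x \<otimes> k)) = padd (padd i (proj x)) (proj w)"
      using i w xhk by (simp add: plus_assoc)
    then have pw: "padd i (proj (x \<otimes> k)) = proj w"
      using i_left w by (simp add: one_plus)
    have "proj (x \<otimes> padd h k) = padd (proj (x \<otimes> h)) (proj w)"
      using mult_plus[of x h k] plus_proj[of "x \<otimes> h" w] xhk w by (simp add: w_def)
    also have "\<dots> = padd (padd (proj (x \<otimes> h)) i) (proj (x \<otimes> k))"
      using xhk i by (simp add: pw[symmetric] plus_assoc)
    finally show "proj (x \<otimes> restricted_sum padd h k) =
      restricted_sum padd (restricted_sum padd (proj (x \<otimes> h)) (inv\<^bsub>?N\<^esub> (proj x))) (proj (x \<otimes> k))"
      using xhk i in_H closed by (simp add: i_def[symmetric] sum_eq)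
  qed
qed

lemma restricted_sum_coset_sum:
  assumes "star \<in> H \<rightarrow>\<^sub>E H \<rightarrow>\<^sub>E H"
  shows "restricted_sum (coset_sum star) = star"
proof -
  have funs: "star \<in> H \<rightarrow> H \<rightarrow> H" using assms by (auto simp: PiE_iff Pi_iff)
  show ?thesis
  proof (intro ext)
    fix h k
    show "restricted_sum (coset_sum star) h k = star h k"
    proof (cases "h \<in> H \<and> k \<in> H")
      case False
      have "h \<notin> H \<Longrightarrow> star h = undefined" using assms by (rule PiE_arb)
      moreover have "h \<in> H \<Longrightarrow> k \<notin> H \<Longrightarrow> star h k = undefined"
        using PiE_mem[OF assms] PiE_arb by metis
      ultimately show ?thesis using False by (auto simp: restricted_sum_def)
    qed (simp add: restricted_sum_def coset_sum_of_H[OF funs])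
  qed
qed

lemma bij_betw_coset_sum:
  "bij_betw (\<lambda>(star, act). coset_sum star) (bracoid_structures G H S) (semibrace_structures G H S)"
proof (rule bij_betw_byWitness[where f' = "\<lambda>padd. (restricted_sum padd, coset_action)"])
  show "\<forall>p \<in> bracoid_structures G H S.
      (restricted_sum ((\<lambda>(star, act). coset_sum star) p), coset_action) = p"
    by (auto simp: bracoid_structures_iff restricted_sum_coset_sum)
  show "\<forall>padd \<in> semibrace_structures G H S.
      (\<lambda>(star, act). coset_sum star) (restricted_sum padd, coset_action) = padd"
    by (simp add: coset_sum_restricted_sum)
  show "(\<lambda>(star, act). coset_sum star) ` bracoid_structures G H S \<subseteq> semibrace_structures G H S"
    by (auto simp: bracoid_structures_iff intro: semibrace_of_bracoid)
  show "(\<lambda>padd. (restricted_sum padd, coset_action)) ` semibrace_structures G H S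
      \<subseteq> bracoid_structures G H S"
    using restricted_sum_closed bracoid_of_semibrace by (auto simp: bracoid_structures_iff)
qed

end

theorem theorem3p5:
  fixes G :: "('a, 'b) monoid_scheme" and H S :: "'a set"
  assumes "exact_factorization G H S"
  shows "\<exists>f. bij_betw f (bracoid_structures G H S) (semibrace_structures G H S)"
  using exact_factorization.bij_betw_coset_sum[OF assms] by blast

end
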